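(* Let $G$ be a finitely generated LERF group with $\nabla G>0$. Then there exists a transitive right action of $G$ on a set $X$ such that: (1) only finitely many elements $g\in G$ act trivially on $X$; and (2) for every finitely generated subgroup $L$ of infinite index in $G$ and every $x\in X$, the orbit $xL$ is finite.
   Context: For a group $U$, $d(U)$ denotes the minimal cardinality of a generating set of $U$. The rank gradient of a finitely generated group $G$ is $\nabla G=\inf_U \frac{d(U)-1}{[G:U]}$, where $U$ ranges over all finite index subgroups of $G$. A group $G$ is LERF (subgroup separable) if every finitely generated subgroup of $G$ is the intersection of some collection of finite index subgroups of $G$. *)

theory Defs
  imports "HOL-Algebra.Algebra" "HOL-Analysis.Analysis"
begin

definition fg_subgroup :: "('a, 'b) monoid_scheme \<Rightarrow> 'a set \<Rightarrow> bool" where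
  "fg_subgroup G H \<longleftrightarrow> subgroup H G \<and>
     (\<exists>S. finite S \<and> S \<subseteq> H \<and> generate G S = H)"

definition min_gens :: "('a, 'b) monoid_scheme \<Rightarrow> 'a set \<Rightarrow> nat" where
  "min_gens G H = (LEAST n. \<exists>S. finite S \<and> S \<subseteq> H \<and> generate G S = H \<and> card S = n)"

definition fi_subgroup :: "('a, 'b) monoid_scheme \<Rightarrow> 'a set \<Rightarrow> bool" where
  "fi_subgroup G U \<longleftrightarrow> subgroup U G \<and> finite (rcosets\<^bsub>G\<^esub> U)"

definition grp_index :: "('a, 'b) monoid_scheme \<Rightarrow> 'a set \<Rightarrow> nat" where
  "grp_index G U = card (rcosets\<^bsub>G\<^esub> U)"

definition rank_gradient :: "('a, 'b) monoid_scheme \<Rightarrow> real" where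
  "rank_gradient G = Inf {(real (min_gens G U) - 1) / real (grp_index G U) | U. fi_subgroup G U}"

definition LERF :: "('a, 'b) monoid_scheme \<Rightarrow> bool" where
  "LERF G \<longleftrightarrow> (\<forall>H. fg_subgroup G H \<longrightarrow>
     (\<exists>\<U>. \<U> \<noteq> {} \<and> (\<forall>U\<in>\<U>. fi_subgroup G U) \<and> H = \<Inter>\<U>))"

definition right_action :: "('a, 'b) monoid_scheme \<Rightarrow> 'c set \<Rightarrow> ('c \<Rightarrow> 'a \<Rightarrow> 'c) \<Rightarrow> bool" where
  "right_action G \<Omega> act \<longleftrightarrow>
     (\<forall>x\<in>\<Omega>. \<forall>g\<in>carrier G. act x g \<in> \<Omega>) \<and>
     (\<forall>x\<in>\<Omega>. act x \<one>\<^bsub>G\<^esub> = x) \<and>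
     (\<forall>x\<in>\<Omega>. \<forall>g\<in>carrier G. \<forall>h\<in>carrier G. act x (g \<otimes>\<^bsub>G\<^esub> h) = act (act x g) h)"

definition transitive_right_action :: "('a, 'b) monoid_scheme \<Rightarrow> 'c set \<Rightarrow> ('c \<Rightarrow> 'a \<Rightarrow> 'c) \<Rightarrow> bool" where
  "transitive_right_action G \<Omega> act \<longleftrightarrow> right_action G \<Omega> act \<and> \<Omega> \<noteq> {} \<and>
     (\<forall>x\<in>\<Omega>. \<forall>y\<in>\<Omega>. \<exists>g\<in>carrier G. act x g = y)"

end

theory Submission
  imports Defs
begin

text \<open>
  Let \<open>c = \<nabla>G\<close>. The action is the one on the right cosets of a subgroup \<open>H\<close> that meets every
  finitely generated subgroup of infinite index in a subgroup of finite index of the latter; since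
  conjugates of such subgroups are of the same kind, all their orbits on \<open>H \ G\<close> are then finite.

  \<open>H\<close> is the union of an ascending chain of finitely generated subgroups \<open>A\<close> of infinite index. To
  extend \<open>A\<close> by a finite index subgroup of \<open>B\<close>, suppose that \<open>B\<close> lies in a finite index subgroup \<open>W\<close>
  such that the \<open>A\<close>-orbit of the base point of \<open>W \ G\<close> is a tiny part of \<open>W \ G\<close>. Let \<open>U \<supseteq> A\<close> be a
  subgroup of large finite index stabilising this orbit. Then \<open>[B : B \<inter> U]\<close> is tiny compared with
  \<open>[G : U]\<close>, so by Schreier's bound \<open>\<langle>A, B \<inter> U\<rangle>\<close> has fewer than \<open>c [G : U]\<close> generators and cannot have
  finite index. Such a \<open>W\<close> exists after passing to a finite index subgroup of \<open>B\<close>: by the same argument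
  applied to \<open>A \<inter> W\<close> with \<open>W \<supseteq> B\<close> of large index (an orbit of size one), \<open>A \<inter> W\<close> and some \<open>B'\<close>
  generate a subgroup \<open>J\<close> of infinite index, and LERF gives \<open>W' \<supseteq> J\<close> of index much larger than
  \<open>[A : A \<inter> W]\<close>.

  A normal subgroup contained in a finitely generated subgroup of infinite index has at most \<open>d(G) / c\<close>
  elements. Hence every finite set \<open>F\<close> with more elements has a conjugate of one of its members outside
  the current \<open>A\<close>, and LERF allows this to be kept along the rest of the chain, so the kernel of the
  action has at most \<open>d(G) / c\<close> elements.
\<close>

section \<open>Orbits on coset spaces and indices\<close>

text \<open>Since \<open>g\<close> factors through \<open>f\<close> on \<open>I\<close>, its image
  is an image of that of \<open>f\<close>. This compares numbers of cosets without quotient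
  maps.\<close>

lemma card_image_le_if_determines:
  assumes "finite (f ` I)" and "\<And>x y. x \<in> I \<Longrightarrow> y \<in> I \<Longrightarrow> f x = f y \<Longrightarrow> g x = g y"
  shows "finite (g ` I)" and "card (g ` I) \<le> card (f ` I)"
proof -
  have "g x = (\<lambda>c. g (inv_into I f c)) (f x)" if "x \<in> I" for x
    using that assms(2)[of x "inv_into I f (f x)"]
    by (simp add: f_inv_into_f inv_into_into)
  then have *: "g ` I = (\<lambda>c. g (inv_into I f c)) ` (f ` I)"
    unfolding image_image by (rule image_cong[OF refl])
  show "finite (g ` I)" using assms(1) by (subst *) (rule finite_imageI)
  show "card (g ` I) \<le> card (f ` I)" using assms(1) by (subst *) (rule card_image_le)
qed

lemma card_image_less_if_determines:
  assumes fin: "finite (f ` I)" and det: "\<And>x y. x \<in> I \<Longrightarrow> y \<in> I \<Longrightarrow> f x = f y \<Longrightarrow> g x = g y"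
    and "x \<in> I" "y \<in> I" "g x = g y" "f x \<noteq> f y"
  shows "card (g ` I) < card (f ` I)"
proof -
  define h where "h c = g (inv_into I f c)" for c
  have h: "h (f z) = g z" if "z \<in> I" for z
    using that det[of "inv_into I f (f z)" z] by (simp add: h_def f_inv_into_f inv_into_into)
  have "g ` I = h ` (f ` I)" unfolding image_image using h by (intro image_cong) auto
  moreover have "card (h ` (f ` I)) \<noteq> card (f ` I)"
  proof
    assume "card (h ` (f ` I)) = card (f ` I)"
    then have "inj_on h (f ` I)" by (rule eq_card_imp_inj_on[OF fin])
    then show False using assms(3-6) h by (auto dest!: inj_onD[of _ _ "f x" "f y"])
  qed
  ultimately show ?thesis using card_image_le[OF fin, of h] by simp
qed

text \<open>The \<open>H\<close>-orbit of the base point of \<open>K \ G\<close>; its size is the index \<open>[H : H \<inter> K]\<close>.\<close>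

definition coset_orbit :: "('a, 'b) monoid_scheme \<Rightarrow> 'a set \<Rightarrow> 'a set \<Rightarrow> 'a set set" where
  "coset_orbit G K H = (\<lambda>h. K #>\<^bsub>G\<^esub> h) ` H"

lemma rcosets_eq_coset_orbit: "rcosets\<^bsub>G\<^esub> K = coset_orbit G K (carrier G)"
  by (auto simp: RCOSETS_def coset_orbit_def)

lemma coset_orbit_mono: "H \<subseteq> H' \<Longrightarrow> coset_orbit G K H \<subseteq> coset_orbit G K H'"
  by (auto simp: coset_orbit_def)

lemma coset_orbit_subset_rcosets: "H \<subseteq> carrier G \<Longrightarrow> coset_orbit G K H \<subseteq> rcosets\<^bsub>G\<^esub> K"
  by (simp add: rcosets_eq_coset_orbit coset_orbit_mono)

context group
begin

lemma r_coset_eq_iff: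
  assumes "subgroup K G" "x \<in> carrier G" "y \<in> carrier G"
  shows "K #> x = K #> y \<longleftrightarrow> x \<otimes> inv y \<in> K"
proof
  assume "K #> x = K #> y"
  then show "x \<otimes> inv y \<in> K"
    using assms coset_join1 coset_mult_inv2 subgroup.subset by (metis inv_closed m_closed)
next
  assume "x \<otimes> inv y \<in> K"
  then have "K #> (x \<otimes> inv y) = K" using assms by (intro coset_join2) auto
  then show "K #> x = K #> y" using assms by (intro coset_mult_inv1) (auto dest: subgroup.subset)
qed

text \<open>Elements of \<open>H\<close> in the same \<open>K\<close>-coset differ by an element of
  \<open>K \<inter> H\<close>. In terms of indices, [H : H \<inter> K'] \<le>
  [H : H \<inter> K].\<close>

lemma coset_orbit_antimono:
  assumes "subgroup K G" "subgroup K' G" "H \<subseteq> carrier G" "K \<inter> H \<subseteq> K'" "subgroup H G"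
    and "finite (coset_orbit G K H)"
  shows "finite (coset_orbit G K' H)" "card (coset_orbit G K' H) \<le> card (coset_orbit G K H)"
proof -
  have "K' #> x = K' #> y" if "x \<in> H" "y \<in> H" "K #> x = K #> y" for x y
  proof -
    have "x \<in> carrier G" "y \<in> carrier G" using that assms(3) by auto
    moreover have "x \<otimes> inv y \<in> H"
      using that assms(5) by (simp add: subgroup.m_closed subgroup.m_inv_closed)
    ultimately show ?thesis
      using that assms(1,2,4) by (auto simp: r_coset_eq_iff)
  qed
  then show "finite (coset_orbit G K' H)" "card (coset_orbit G K' H) \<le> card (coset_orbit G K H)"
    using card_image_le_if_determines[of "\<lambda>h. K #> h" H "\<lambda>h. K' #> h"] assms(6)
    unfolding coset_orbit_def by blast+
qed

lemma finite_rcosets_Int: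
  assumes "subgroup H G" "subgroup K G" "finite (rcosets H)" "finite (rcosets K)"
  shows "finite (rcosets (H \<inter> K))"
proof -
  let ?f = "\<lambda>g. (H #> g, K #> g)"
  have "finite (?f ` carrier G)"
  proof (rule finite_subset)
    show "?f ` carrier G \<subseteq> (rcosets H) \<times> rcosets K" by (auto simp: RCOSETS_def)
  qed (use assms in simp)
  moreover have "(H \<inter> K) #> x = (H \<inter> K) #> y"
    if "x \<in> carrier G" "y \<in> carrier G" "?f x = ?f y" for x y
    using that assms(1,2) by (simp add: r_coset_eq_iff subgroups_Inter_pair)
  ultimately show ?thesis
    unfolding rcosets_eq_coset_orbit coset_orbit_def by (rule card_image_le_if_determines(1))
qed

text \<open>The tower formula [G : H \<inter> K] = [G : H] [H : H \<inter> K]. Each \<open>g\<close>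
  is an element of \<open>H\<close> times the representative \<open>r (H #> g)\<close>; its coset
  modulo \<open>H \<inter> K\<close> amounts to the pair of \<open>H #> g\<close> and the
  \<open>K\<close>-coset of that element of \<open>H\<close>.\<close>

lemma card_rcosets_Int:
  assumes H: "subgroup H G" and K: "subgroup K G" and fin: "finite (rcosets (H \<inter> K))"
  shows "card (rcosets (H \<inter> K)) = card (rcosets H) * card (coset_orbit G K H)"
proof -
  define r where "r C = (SOME g. g \<in> carrier G \<and> H #> g = C)" for C
  have r: "r (H #> g) \<in> carrier G" "H #> r (H #> g) = H #> g" if "g \<in> carrier G" for g
    using someI_ex[of "\<lambda>g'. g' \<in> carrier G \<and> H #> g' = H #> g"] that by (auto simp: r_def)
  have rH: "g \<otimes> inv (r (H #> g)) \<in> H" if "g \<in> carrier G" for g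
    using r[OF that] that r_coset_eq_iff[OF H that, of "r (H #> g)"] by auto
  let ?f = "\<lambda>g. (H #> g, K #> (g \<otimes> inv (r (H #> g))))"
  let ?g = "\<lambda>g. (H \<inter> K) #> g"
  have HK: "subgroup (H \<inter> K) G" using H K by (rule subgroups_Inter_pair)
  have key: "?f x = ?f y \<longleftrightarrow> ?g x = ?g y" if x: "x \<in> carrier G" and y: "y \<in> carrier G" for x y
  proof -
    have "K #> (x \<otimes> inv (r (H #> x))) = K #> (y \<otimes> inv (r (H #> y))) \<longleftrightarrow> x \<otimes> inv y \<in> K"
      if eq: "H #> x = H #> y"
    proof -
      let ?r = "r (H #> y)"
      have rc: "?r \<in> carrier G" using r y by simp
      have "x \<otimes> inv ?r \<otimes> inv (y \<otimes> inv ?r) = x \<otimes> inv y"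
        using x y rc by (simp add: inv_mult_group m_assoc flip: m_assoc[of "inv ?r" ?r])
      then show ?thesis
        unfolding eq using x y rc by (subst r_coset_eq_iff[OF K]) auto
    qed
    then show ?thesis using x y H K HK by (auto simp: r_coset_eq_iff)
  qed
  have "?f ` carrier G = (rcosets H) \<times> coset_orbit G K H"
  proof
    show "?f ` carrier G \<subseteq> (rcosets H) \<times> coset_orbit G K H"
      using rH by (auto simp: RCOSETS_def coset_orbit_def)
    show "(rcosets H) \<times> coset_orbit G K H \<subseteq> ?f ` carrier G"
    proof clarify
      fix C D assume "C \<in> rcosets H" "D \<in> coset_orbit G K H"
      then obtain g h where g: "g \<in> carrier G" "C = H #> g" and h: "h \<in> H" "D = K #> h"
        by (auto simp: RCOSETS_def coset_orbit_def)
      let ?x = "h \<otimes> r C"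
      have hc: "h \<in> carrier G" using subgroup.subset[OF H] h(1) by auto
      have rc: "r C \<in> carrier G" "H #> r C = C" using r g by auto
      have "H #> ?x = H #> r C"
        using h hc rc H by (subst r_coset_eq_iff) (auto simp: m_assoc)
      then have "H #> ?x = C" using rc by simp
      moreover have "?x \<otimes> inv (r C) = h" using hc rc by (simp add: m_assoc)
      ultimately have fx: "?f ?x = (C, D)" using h by simp
      have "?x \<in> carrier G" using hc rc by simp
      then show "(C, D) \<in> ?f ` carrier G" by (rule image_eqI[where f = ?f and x = ?x, OF fx[symmetric]])
    qed
  qed
  moreover have "card (?f ` carrier G) = card (?g ` carrier G)"
  proof (rule antisym)
    have fin': "finite (?g ` carrier G)"
      using fin by (simp add: rcosets_eq_coset_orbit coset_orbit_def)
    have fg: "\<And>x y. x \<in> carrier G \<Longrightarrow> y \<in> carrier G \<Longrightarrow> ?g x = ?g y \<Longrightarrow> ?f x = ?f y"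
      and gf: "\<And>x y. x \<in> carrier G \<Longrightarrow> y \<in> carrier G \<Longrightarrow> ?f x = ?f y \<Longrightarrow> ?g x = ?g y"
      by (rule key[THEN iffD2], assumption+) (rule key[THEN iffD1], assumption+)
    note le = card_image_le_if_determines[where f = ?g and g = ?f, OF fin' fg]
    show "card (?f ` carrier G) \<le> card (?g ` carrier G)" by (rule le(2))
    show "card (?g ` carrier G) \<le> card (?f ` carrier G)"
      by (rule card_image_le_if_determines(2)[where f = ?f and g = ?g, OF le(1) gf])
  qed
  ultimately show ?thesis
    by (simp add: card_cartesian_product rcosets_eq_coset_orbit coset_orbit_def)
qed

text \<open>Every \<open>b\<close> in \<open>B\<close> is an element of \<open>H\<close> times one
  of finitely many representatives, so finitely many translates of the orbit of \<open>H\<close>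
  cover that of \<open>B\<close>.\<close>

lemma finite_coset_orbit_trans:
  assumes "subgroup K G" "subgroup H G" "subgroup B G"
    and "finite (coset_orbit G K H)" "finite (coset_orbit G H B)" "H \<subseteq> B"
  shows "finite (coset_orbit G K B)"
proof -
  obtain R where R: "R \<subseteq> B" "finite R" "coset_orbit G H B = (\<lambda>h. H #> h) ` R"
    using finite_subset_image[OF assms(5), of "\<lambda>h. H #> h" B] unfolding coset_orbit_def by blast
  have "coset_orbit G K B \<subseteq> (\<Union>r\<in>R. (\<lambda>C. C #> r) ` coset_orbit G K H)"
  proof
    fix C assume "C \<in> coset_orbit G K B"
    then obtain b where b: "b \<in> B" "C = K #> b" by (auto simp: coset_orbit_def)
    then have "H #> b \<in> (\<lambda>h. H #> h) ` R"
      using R(3) by (auto simp: coset_orbit_def)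
    then obtain r where r: "r \<in> R" "H #> b = H #> r" by auto
    have c: "b \<in> carrier G" "r \<in> carrier G"
      using b r R(1) subgroup.subset[OF assms(3)] by auto
    have "b \<otimes> inv r \<in> H" using r c r_coset_eq_iff[OF assms(2)] by blast
    moreover have "C = (K #> (b \<otimes> inv r)) #> r"
      using b c subgroup.subset[OF assms(1)] by (simp add: coset_mult_assoc m_assoc)
    ultimately show "C \<in> (\<Union>r\<in>R. (\<lambda>C. C #> r) ` coset_orbit G K H)"
      using r by (auto simp: coset_orbit_def)
  qed
  then show ?thesis using R(2) assms(4) finite_subset by fastforce
qed

text \<open>Schreier's lemma, with [B : B \<inter> U] written as an orbit size. The Schreier
  generators are the \<open>w C s\<close> for \<open>C\<close> in the orbit and \<open>s\<close> in
  \<open>T\<close>.\<close>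

lemma schreier_generators:
  assumes T: "T \<subseteq> carrier G" "finite T" "generate G T = B"
    and U: "subgroup U G" and fin: "finite (coset_orbit G U B)"
  shows "\<exists>T'. finite T' \<and> T' \<subseteq> B \<inter> U \<and> generate G T' = B \<inter> U \<and>
    card T' \<le> card (coset_orbit G U B) * card T"
proof -
  have B: "subgroup B G" using T generate_is_subgroup by blast
  have Bc: "B \<subseteq> carrier G" and Uc: "U \<subseteq> carrier G" using B U subgroup.subset by auto
  let ?O = "coset_orbit G U B"
  \<comment> \<open>Representing \<open>U\<close> by \<open>\<one>\<close> gives
    \<open>w U b = b\<close> for \<open>b\<close> in \<open>B \<inter> U\<close>, so it suffices to
    generate all \<open>w C b\<close>.\<close>
  define r where "r C = (if C = U then \<one> else SOME g. g \<in> B \<and> U #> g = C)" for C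
  have r: "r C \<in> B" "U #> r C = C" if "C \<in> ?O" for C
    using that someI_ex[of "\<lambda>g. g \<in> B \<and> U #> g = C"] B Uc
    by (auto simp: r_def coset_orbit_def subgroup.one_closed)
  have rc: "r C \<in> carrier G" if "C \<in> ?O" for C using r(1)[OF that] Bc by auto
  have act: "C #> b \<in> ?O" if "C \<in> ?O" "b \<in> B" for C b
    using that B Bc Uc by (auto simp: coset_orbit_def coset_mult_assoc subsetD subgroup.m_closed)
  have assoc: "C #> b #> b' = C #> (b \<otimes> b')" if "C \<in> ?O" "b \<in> B" "b' \<in> B" for C b b'
    using that Bc Uc by (intro coset_mult_assoc) (auto simp: coset_orbit_def r_coset_def)
  have one: "C #> \<one> = C" if "C \<in> ?O" for C
    using that Bc Uc by (intro coset_mult_one) (auto simp: coset_orbit_def r_coset_def)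
  define w where "w C b = r C \<otimes> b \<otimes> inv (r (C #> b))" for C b
  define T' where "T' = (\<lambda>(C, s). w C s) ` (?O \<times> T)"
  have TB: "T \<subseteq> B" using T(3) generate.incl by fast
  have wBU: "w C b \<in> B \<inter> U" if C: "C \<in> ?O" and b: "b \<in> B" for C b
  proof
    show "w C b \<in> B"
      using r(1)[OF C] r(1)[OF act[OF C b]] b B
      by (simp add: w_def subgroup.m_closed subgroup.m_inv_closed)
    have "U #> (r C \<otimes> b) = U #> r (C #> b)"
      using r(2)[OF C] r(2)[OF act[OF C b]] rc[OF C] b Bc Uc
      by (metis coset_mult_assoc subsetD)
    then show "w C b \<in> U"
      using U rc[OF C] rc[OF act[OF C b]] b Bc unfolding w_def
      by (subst (asm) r_coset_eq_iff) auto
  qed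
  have T'BU: "T' \<subseteq> B \<inter> U" using wBU TB by (auto simp: T'_def)
  have BU: "subgroup (B \<inter> U) G" using B U by (rule subgroups_Inter_pair)
  have T'c: "T' \<subseteq> carrier G" using T'BU Uc by auto
  \<comment> \<open>The cocycle identity
    \<open>w C (h1 \<otimes> h2) = w C h1 \<otimes> w (C #> h1) h2\<close> turns words in
    \<open>T\<close> into products of Schreier generators; it moves the coset, so \<open>C\<close>
    stays arbitrary in the induction.\<close>
  have wT': "w C b \<in> generate G T'" if "b \<in> generate G T" "C \<in> ?O" for b C
    using that
  proof (induction b arbitrary: C rule: generate.induct)
    case one
    then show ?case
      using rc[OF one] by (simp add: w_def \<open>C \<in> ?O \<Longrightarrow> C #> \<one> = C\<close> generate.one)
  next
    case (incl h)
    then show ?case by (auto simp: T'_def intro!: generate.incl)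
  next
    case (inv h)
    have h: "h \<in> B" "h \<in> carrier G" using inv TB Bc by auto
    then have ih: "inv h \<in> B" using B by (simp add: subgroup.m_inv_closed)
    let ?D = "C #> inv h"
    have D: "?D \<in> ?O" using act[OF inv(2) ih] .
    have Dh: "?D #> h = C" using assoc[OF inv(2) ih h(1)] one[OF inv(2)] h by simp
    have "w C (inv h) = inv (w ?D h)"
      using rc[OF D] rc[OF inv(2)] h by (simp add: w_def Dh inv_mult_group m_assoc)
    moreover have "w ?D h \<in> generate G T'"
      using D inv(1) by (auto simp: T'_def intro!: generate.incl)
    ultimately show ?case using generate_m_inv_closed[OF T'c] by simp
  next
    case (eng h1 h2)
    have h: "h1 \<in> B" "h2 \<in> B" "h1 \<in> carrier G" "h2 \<in> carrier G" using eng(1,2) T(3) Bc by auto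
    have D: "C #> h1 \<in> ?O" using act[OF eng(5) h(1)] .
    have E: "C #> (h1 \<otimes> h2) \<in> ?O" using act[OF D h(2)] assoc[OF eng(5) h(1,2)] by simp
    have "w C (h1 \<otimes> h2) = w C h1 \<otimes> w (C #> h1) h2"
      using rc[OF eng(5)] rc[OF D] rc[OF E] h assoc[OF eng(5) h(1,2)]
      by (simp add: w_def m_assoc flip: m_assoc[of "inv (r (C #> h1))" "r (C #> h1)"])
    then show ?case using eng.IH(1)[OF eng(5)] eng.IH(2)[OF D] generate.eng by fastforce
  qed
  have UO: "U \<in> ?O"
    unfolding coset_orbit_def using Uc B by (intro image_eqI[of _ _ \<one>]) (auto simp: subgroup.one_closed)
  have "B \<inter> U \<subseteq> generate G T'"
  proof
    fix b assume b: "b \<in> B \<inter> U"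
    then have "U #> b = U" using U Uc by (intro coset_join2) auto
    then have "w U b = b" using b Bc by (auto simp: w_def r_def)
    then show "b \<in> generate G T'" using wT'[of b U] b UO T(3) by auto
  qed
  moreover have "generate G T' \<subseteq> B \<inter> U" using T'BU BU by (rule generate_subgroup_incl)
  moreover have "card T' \<le> card ?O * card T"
    unfolding T'_def using card_image_le[of "?O \<times> T" "\<lambda>(C, s). w C s"] fin T(2)
    by (simp add: card_cartesian_product)
  moreover have "finite T'" using fin T(2) by (simp add: T'_def)
  ultimately show ?thesis using T'BU by blast
qed

section \<open>Finitely generated subgroups and finite index subgroups\<close>

lemma infinite_rcosets_antimono:
  assumes "subgroup A G" "subgroup A' G" "A' \<subseteq> A" "infinite (rcosets A)"
  shows "infinite (rcosets A')"
  using assms(4) coset_orbit_antimono(1)[OF assms(2,1) order_refl _ subgroup_self] assms(3)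
  unfolding rcosets_eq_coset_orbit by blast

lemma fg_subgroupE:
  assumes "fg_subgroup G H"
  obtains T where "finite T" "T \<subseteq> carrier G" "generate G T = H"
proof -
  obtain T where "finite T" "T \<subseteq> H" "generate G T = H" "H \<subseteq> carrier G"
    using assms subgroup.subset unfolding fg_subgroup_def by blast
  then show thesis using that[of T] by auto
qed

lemma fg_subgroup_generate:
  assumes "finite T" "T \<subseteq> carrier G"
  shows "fg_subgroup G (generate G T)"
  unfolding fg_subgroup_def using assms generate_is_subgroup
  by (intro conjI exI[of _ T]) (auto intro: generate.incl)

lemma generate_Un_generate:
  assumes "S \<subseteq> carrier G" "T \<subseteq> carrier G"
  shows "generate G (generate G S \<union> generate G T) = generate G (S \<union> T)"
proof
  show "generate G (generate G S \<union> generate G T) \<subseteq> generate G (S \<union> T)"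
    using assms by (intro generate_subgroup_incl generate_is_subgroup Un_least mono_generate) auto
  show "generate G (S \<union> T) \<subseteq> generate G (generate G S \<union> generate G T)"
    by (intro mono_generate) (auto intro: generate.incl)
qed

lemma fi_subgroup_Int:
  "fi_subgroup G U \<Longrightarrow> fi_subgroup G V \<Longrightarrow> fi_subgroup G (U \<inter> V)"
  unfolding fi_subgroup_def by (simp add: finite_rcosets_Int subgroups_Inter_pair)

lemma fi_subgroup_carrier: "fi_subgroup G (carrier G)"
proof -
  have "rcosets (carrier G) \<subseteq> {carrier G}"
    using coset_join2[OF _ subgroup_self] by (auto simp: RCOSETS_def)
  then show ?thesis
    unfolding fi_subgroup_def using finite_subset subgroup_self by blast
qed

lemma fi_subgroup_finite_coset_orbit:
  assumes "fi_subgroup G U" "H \<subseteq> carrier G"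
  shows "finite (coset_orbit G U H)"
  using finite_subset[OF coset_orbit_subset_rcosets[OF assms(2)]] assms(1)
  unfolding fi_subgroup_def by simp

lemma card_rcosets_pos:
  assumes "fi_subgroup G U"
  shows "card (rcosets U) > 0"
  using assms subgroup.subgroup_in_rcosets[OF _ group_axioms, of U] unfolding fi_subgroup_def
  by (auto simp: card_gt_0_iff)

text \<open>The orbit of \<open>H\<close> lies in that of \<open>V\<close>, which has
  [V : V \<inter> U] points; the tower formula does the rest.\<close>

lemma card_coset_orbit_le:
  assumes "fi_subgroup G U" "fi_subgroup G V" "H \<subseteq> V"
  shows "card (coset_orbit G U H) * card (rcosets V) \<le> card (rcosets (V \<inter> U))"
proof -
  have V: "V \<subseteq> carrier G" using assms(2) subgroup.subset unfolding fi_subgroup_def by blast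
  have "card (coset_orbit G U H) \<le> card (coset_orbit G U V)"
    using assms V by (intro card_mono coset_orbit_mono fi_subgroup_finite_coset_orbit)
  moreover have "card (rcosets (V \<inter> U)) = card (rcosets V) * card (coset_orbit G U V)"
    using assms fi_subgroup_Int[of V U] by (intro card_rcosets_Int) (auto simp: fi_subgroup_def)
  ultimately show ?thesis by (simp add: mult.commute)
qed

section \<open>Finite index subgroups of LERF groups\<close>

lemma LERF_fi_subgroup_avoiding:
  assumes "LERF G" "fg_subgroup G A" "x \<notin> A"
  obtains U where "fi_subgroup G U" "A \<subseteq> U" "x \<notin> U"
proof -
  obtain \<U> where "\<forall>U\<in>\<U>. fi_subgroup G U" "A = \<Inter>\<U>"
    using assms(1,2) unfolding LERF_def by blast
  then show thesis using assms(3) that by blast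
qed

text \<open>The orbit grows by at least one point at a time. If
  \<open>U \<inter> M \<subseteq> A\<close>, the orbit on the cosets of \<open>U\<close> is already
  as large as the one on the cosets of \<open>A\<close>. Otherwise LERF gives
  \<open>V \<supseteq> A\<close> omitting some \<open>u\<close> in \<open>U \<inter> M\<close>, and
  passing to \<open>U \<inter> V\<close> separates the coset of \<open>u\<close> from the base
  point.\<close>

lemma LERF_large_coset_orbit:
  assumes "LERF G" "fg_subgroup G A" "subgroup M G"
    and "finite (coset_orbit G A M) \<Longrightarrow> N \<le> card (coset_orbit G A M)"
  shows "\<exists>U. fi_subgroup G U \<and> A \<subseteq> U \<and> N \<le> card (coset_orbit G U M)"
  using assms(4)
proof (induction N)
  case 0
  show ?case
    using assms(2) fi_subgroup_carrier subgroup.subset unfolding fg_subgroup_def by blast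
next
  case (Suc N)
  then obtain U where U: "fi_subgroup G U" "A \<subseteq> U" "N \<le> card (coset_orbit G U M)"
    using Suc_leD by blast
  have sub: "subgroup A G" "subgroup U G" and Mc: "M \<subseteq> carrier G"
    using assms U subgroup.subset by (auto simp: fg_subgroup_def fi_subgroup_def)
  show ?case
  proof (cases "U \<inter> M \<subseteq> A")
    case True
    note orbit = coset_orbit_antimono[OF sub(2,1) Mc True assms(3)
        fi_subgroup_finite_coset_orbit[OF U(1) Mc]]
    show ?thesis using U(1,2) orbit(2) Suc.prems[OF orbit(1)] order_trans by blast
  next
    case False
    then obtain u where u: "u \<in> U" "u \<in> M" "u \<notin> A" by blast
    obtain V where V: "fi_subgroup G V" "A \<subseteq> V" "u \<notin> V"
      using LERF_fi_subgroup_avoiding[OF assms(1,2) u(3)] .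
    have UV: "fi_subgroup G (U \<inter> V)" using U(1) V(1) by (rule fi_subgroup_Int)
    then have subUV: "subgroup (U \<inter> V) G" by (simp add: fi_subgroup_def)
    have "card ((\<lambda>h. U #> h) ` M) < card ((\<lambda>h. (U \<inter> V) #> h) ` M)"
    proof (rule card_image_less_if_determines)
      show "finite ((\<lambda>h. (U \<inter> V) #> h) ` M)"
        using fi_subgroup_finite_coset_orbit[OF UV Mc] by (simp add: coset_orbit_def)
      show "U #> x = U #> y" if "x \<in> M" "y \<in> M" "(U \<inter> V) #> x = (U \<inter> V) #> y" for x y
        using that Mc r_coset_eq_iff[OF sub(2), of x y] r_coset_eq_iff[OF subUV, of x y] by auto
      show "u \<in> M" "\<one> \<in> M" using u assms(3) subgroup.one_closed by auto
      then show "U #> u = U #> \<one>" "(U \<inter> V) #> u \<noteq> (U \<inter> V) #> \<one>"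
        using u V(3) Mc r_coset_eq_iff[OF sub(2), of u \<one>] r_coset_eq_iff[OF subUV, of u \<one>]
        by (simp_all add: subsetD)
    qed
    then have "Suc N \<le> card (coset_orbit G (U \<inter> V) M)"
      using U(3) by (simp add: coset_orbit_def)
    then show ?thesis using UV U(2) V(2) by blast
  qed
qed

text \<open>Clearing the denominator and dropping the -1 gives the form in which the rank gradient
  enters the counting arguments.\<close>

lemma rank_gradient_le_card_generators:
  assumes U: "fi_subgroup G U" and T: "finite T" "T \<subseteq> carrier G" "generate G T = U"
  shows "rank_gradient G * card (rcosets U) \<le> card T"
proof -
  let ?S = "{(real (min_gens G U) - 1) / real (grp_index G U) | U. fi_subgroup G U}"
  \<comment> \<open>A real infimum is known to be a lower bound only for a set bounded below. The
    bound -1 also covers the formal case of index 0, where the quotient is 0.\<close>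
  have "bdd_below ?S"
  proof (rule bdd_belowI)
    fix z assume "z \<in> ?S"
    then obtain V where "z = (real (min_gens G V) - 1) / real (grp_index G V)" by blast
    moreover have "- real n \<le> real m - 1" if "n > 0" for n m :: nat using that by simp
    ultimately show "-1 \<le> z"
      by (cases "grp_index G V = 0") (simp_all add: le_divide_eq)
  qed
  then have "rank_gradient G \<le> (real (min_gens G U) - 1) / real (grp_index G U)"
    unfolding rank_gradient_def using U by (intro cInf_lower) auto
  then have "rank_gradient G * card (rcosets U) \<le> real (min_gens G U) - 1"
    using card_rcosets_pos[OF U] by (simp add: grp_index_def field_simps)
  moreover have "T \<subseteq> U" using T(3) generate.incl[of _ T G] by blast
  then have "min_gens G U \<le> card T"
    unfolding min_gens_def using T by (intro Least_le) auto
  ultimately show ?thesis by linarith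
qed

text \<open>The subgroup is the setwise stabiliser of the \<open>A\<close>-orbit of the base point of \<open>W \ G\<close>.\<close>

lemma ex_fi_subgroup_same_coset_orbit:
  assumes W: "fi_subgroup G W" and A: "subgroup A G"
  shows "\<exists>U. fi_subgroup G U \<and> A \<subseteq> U \<and> coset_orbit G W U \<subseteq> coset_orbit G W A"
proof -
  let ?O = "coset_orbit G W A"
  define f where "f g = (\<lambda>C. C #> g) ` ?O" for g
  define U where "U = {g \<in> carrier G. f g = ?O}"
  have Wc: "W \<subseteq> carrier G" and Ac: "A \<subseteq> carrier G" and Ws: "subgroup W G"
    using W A subgroup.subset by (auto simp: fi_subgroup_def)
  have Cc: "C \<subseteq> carrier G" if "C \<in> ?O" for C
    using that Ac Wc by (auto simp: coset_orbit_def r_coset_def)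
  have f_mult: "f (g \<otimes> h) = (\<lambda>C. C #> h) ` f g" if "g \<in> carrier G" "h \<in> carrier G" for g h
    unfolding f_def image_image using that Cc by (intro image_cong) (auto simp: coset_mult_assoc)
  have f_one: "f \<one> = ?O" unfolding f_def using Cc by simp
  have f_cancel: "f (x \<otimes> inv y) = ?O" if "x \<in> carrier G" "y \<in> carrier G" "f x = f y" for x y
    using that f_mult[of x "inv y"] f_mult[of y "inv y"] f_one by simp
  have U: "subgroup U G"
  proof (rule subgroupI)
    show "U \<subseteq> carrier G" "U \<noteq> {}" using f_one by (auto simp: U_def)
    show "inv a \<in> U" if "a \<in> U" for a
      using that f_cancel[of \<one> a] f_one by (simp add: U_def)
    show "a \<otimes> b \<in> U" if "a \<in> U" "b \<in> U" for a b
      using that f_mult[of a b] by (simp add: U_def) (simp add: f_def)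
  qed
  \<comment> \<open>The coset \<open>U #> g\<close> is determined by the translate
    \<open>f g\<close>, a subset of the finite set \<open>rcosets W\<close>.\<close>
  have "finite ((\<lambda>g. U #> g) ` carrier G)"
  proof (rule card_image_le_if_determines(1))
    have "f ` carrier G \<subseteq> Pow (rcosets W)"
      using Wc Ac by (auto simp: f_def coset_orbit_def coset_mult_assoc subsetD intro!: rcosetsI)
    then show "finite (f ` carrier G)"
      using W finite_subset unfolding fi_subgroup_def by blast
    show "U #> x = U #> y" if "x \<in> carrier G" "y \<in> carrier G" "f x = f y" for x y
      using that f_cancel[OF that] U by (subst r_coset_eq_iff) (auto simp: U_def)
  qed
  then have "fi_subgroup G U"
    using U by (simp add: fi_subgroup_def rcosets_eq_coset_orbit coset_orbit_def)
  moreover have "A \<subseteq> U"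
  proof
    fix a assume a: "a \<in> A"
    have sub: "f b \<subseteq> ?O" if "b \<in> A" for b
      using that A Ac Wc
      by (auto simp: f_def coset_orbit_def coset_mult_assoc subsetD subgroup.m_closed)
    have ia: "inv a \<in> A" "a \<in> carrier G" using a A Ac by (auto simp: subgroup.m_inv_closed)
    have "?O = (\<lambda>C. C #> a) ` f (inv a)" using f_mult[of "inv a" a] ia f_one by simp
    also have "\<dots> \<subseteq> f a" using sub[OF ia(1)] unfolding f_def[of a] by blast
    finally show "a \<in> U" using sub[OF a] ia by (auto simp: U_def)
  qed
  moreover have "coset_orbit G W U \<subseteq> ?O"
  proof -
    have "W \<in> ?O"
      unfolding coset_orbit_def using Wc A
      by (intro image_eqI[of _ _ \<one>]) (auto simp: subgroup.one_closed)
    then have "W #> u \<in> f u" for u by (simp add: f_def)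
    then have "W #> u \<in> ?O" if "u \<in> U" for u using that by (auto simp: U_def)
    then show ?thesis unfolding coset_orbit_def[of G W U] by blast
  qed
  ultimately show ?thesis by blast
qed

section \<open>Generated subgroups and conjugates\<close>

lemma set_mult_normal_subgroup:
  assumes "M \<lhd> G" "subgroup H G"
  shows "subgroup (M <#> H) G"
  using assms
  by (intro second_isomorphism_grp.normal_set_mult_subgroup)
    (simp add: second_isomorphism_grp_def second_isomorphism_grp_axioms_def)

text \<open>Every element is the product of a finite word in \<open>S\<close> and the inverses of
  its elements.\<close>

lemma countable_generate:
  assumes "countable S" "S \<subseteq> carrier G"
  shows "countable (generate G S)"
proof -
  let ?S = "S \<union> m_inv G ` S"
  let ?p = "\<lambda>l. foldr (\<otimes>) l \<one>"
  have S: "?S \<subseteq> carrier G" using assms(2) by auto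
  have closed: "?p l \<in> carrier G" if "l \<in> lists ?S" for l
    using that S by (induction l) auto
  have append: "?p (l @ l') = ?p l \<otimes> ?p l'" if "l \<in> lists ?S" "l' \<in> lists ?S" for l l'
    using that(1)
  proof (induction l)
    case Nil
    then show ?case using closed[OF that(2)] by simp
  next
    case (Cons a l)
    have "a \<in> carrier G" using Cons.hyps(1) S by auto
    then show ?case
      using closed[OF Cons.hyps(2)] closed[OF that(2)] Cons.IH
      by (simp add: m_assoc del: foldr_append)
  qed
  have "generate G S \<subseteq> ?p ` lists ?S"
  proof
    fix x assume "x \<in> generate G S"
    then show "x \<in> ?p ` lists ?S"
    proof induction
      case one
      show ?case by (rule image_eqI[of _ _ "[]"]) auto
    next
      case (incl h)
      then show ?case using assms(2) by (intro image_eqI[of _ _ "[h]"]) auto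
    next
      case (inv h)
      then show ?case using assms(2) by (intro image_eqI[of _ _ "[inv h]"]) auto
    next
      case (eng h1 h2)
      then obtain l1 l2 where l: "l1 \<in> lists ?S" "h1 = ?p l1" "l2 \<in> lists ?S" "h2 = ?p l2"
        by (auto simp del: in_lists_conv_set)
      show ?case
        using l append[OF l(1,3)] by (intro image_eqI[of _ _ "l1 @ l2"]) auto
    qed
  qed
  moreover have "countable (lists ?S)" using assms(1) by (intro countable_lists) auto
  ultimately show ?thesis by (rule countable_subset[OF _ countable_image])
qed

lemma fg_subgroup_one: "fg_subgroup G {\<one>}"
  using fg_subgroup_generate[of "{}"] generate_empty by simp

lemma coset_orbit_one:
  assumes "H \<subseteq> carrier G"
  shows "coset_orbit G {\<one>} H = (\<lambda>h. {h}) ` H"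
  unfolding coset_orbit_def using assms by (intro image_cong) (auto simp: r_coset_def)

text \<open>This set generates the normal closure of \<open>F\<close>. If \<open>F\<close> acts
  trivially on the cosets of \<open>H\<close>, the whole set lies in \<open>H\<close>.\<close>

definition conjugates :: "'a set \<Rightarrow> 'a set" where
  "conjugates F = (\<Union>x\<in>carrier G. (\<lambda>f. x \<otimes> f \<otimes> inv x) ` F)"

lemma subset_conjugates:
  assumes "F \<subseteq> carrier G"
  shows "F \<subseteq> conjugates F"
proof
  fix f assume f: "f \<in> F"
  then have "f = \<one> \<otimes> f \<otimes> inv \<one>" using assms by auto
  then show "f \<in> conjugates F" unfolding conjugates_def using f by blast
qed

lemma generate_conjugates_normal:
  assumes "F \<subseteq> carrier G"
  shows "generate G (conjugates F) \<lhd> G"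
proof (rule normal_generateI)
  show "conjugates F \<subseteq> carrier G" using assms by (auto simp: conjugates_def)
  fix h g assume "h \<in> conjugates F" and g: "g \<in> carrier G"
  then obtain x f where xf: "x \<in> carrier G" "f \<in> F" "h = x \<otimes> f \<otimes> inv x"
    by (auto simp: conjugates_def)
  have "f \<in> carrier G" using xf assms by auto
  then have "g \<otimes> h \<otimes> inv g = (g \<otimes> x) \<otimes> f \<otimes> inv (g \<otimes> x)"
    using xf g by (simp add: m_assoc inv_mult_group)
  then show "g \<otimes> h \<otimes> inv g \<in> conjugates F"
    using xf(1,2) g unfolding conjugates_def by blast
qed

end

section \<open>Joins of infinite index\<close>

locale LERF_positive_rank_gradient = group +
  assumes LERF: "LERF G" and rank_gradient_pos: "rank_gradient G > 0"
begin

lemma ex_fi_subgroup_large_index: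
  assumes "fg_subgroup G A" "infinite (rcosets A)"
  obtains U where "fi_subgroup G U" "A \<subseteq> U" "c < rank_gradient G * card (rcosets U)"
proof -
  obtain N :: nat where N: "c < rank_gradient G * N"
    using reals_Archimedean3[OF rank_gradient_pos] by (metis mult.commute)
  obtain U where U: "fi_subgroup G U" "A \<subseteq> U" "N \<le> card (rcosets U)"
    using LERF_large_coset_orbit[OF LERF assms(1) subgroup_self, of N] assms(2)
    unfolding rcosets_eq_coset_orbit by blast
  have "rank_gradient G * N \<le> rank_gradient G * card (rcosets U)"
    using U(3) rank_gradient_pos by simp
  then show thesis using that U N by (meson less_le_trans)
qed

text \<open>The join \<open>V\<close> lies in \<open>U\<close>, so if its index were finite, it
  would need at least c [G : U] generators, where c is the rank gradient. The factors 2 in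
  \<open>small\<close> and in the choice of \<open>U'\<close> leave less than half of this to the
  generators of \<open>A\<close> and less than half to the Schreier generators of
  \<open>generate G T \<inter> U\<close>.\<close>

lemma ex_finite_index_join_infinite_index_aux:
  assumes A: "fg_subgroup G A" "infinite (rcosets A)"
    and T: "finite T" "T \<subseteq> carrier G"
    and W: "fi_subgroup G W" "generate G T \<subseteq> W"
    and small: "2 * card (coset_orbit G W A) * card T < rank_gradient G * card (rcosets W)"
    and U0: "fi_subgroup G U0" "A \<subseteq> U0"
  shows "\<exists>B0. fg_subgroup G B0 \<and> B0 \<subseteq> generate G T \<inter> U0 \<and>
    finite (coset_orbit G B0 (generate G T)) \<and> infinite (rcosets (generate G (A \<union> B0)))"
proof -
  let ?B = "generate G T" and ?c = "rank_gradient G"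
  obtain TA where TA: "finite TA" "TA \<subseteq> carrier G" "generate G TA = A"
    using fg_subgroupE[OF A(1)] .
  have sA: "subgroup A G" and Ac: "A \<subseteq> carrier G"
    using A(1) subgroup.subset by (auto simp: fg_subgroup_def)
  have sB: "subgroup ?B G" and Bc: "?B \<subseteq> carrier G"
    using T generate_is_subgroup generate_incl by auto
  have sW: "subgroup W G" and Wc: "W \<subseteq> carrier G"
    using W(1) subgroup.subset by (auto simp: fi_subgroup_def)
  obtain U' where U': "fi_subgroup G U'" "A \<subseteq> U'" "2 * real (card TA) < ?c * card (rcosets U')"
    using ex_fi_subgroup_large_index[OF A] by blast
  obtain U1 where U1: "fi_subgroup G U1" "A \<subseteq> U1" "coset_orbit G W U1 \<subseteq> coset_orbit G W A"
    using ex_fi_subgroup_same_coset_orbit[OF W(1) sA] by blast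
  define U where "U = U1 \<inter> (U' \<inter> U0)"
  have U: "fi_subgroup G U" unfolding U_def using U1(1) U'(1) U0(1) by (intro fi_subgroup_Int)
  have sU: "subgroup U G" using U by (simp add: fi_subgroup_def)
  have finO: "finite (coset_orbit G U ?B)" using fi_subgroup_finite_coset_orbit[OF U Bc] .
  obtain T' where T': "finite T'" "T' \<subseteq> ?B \<inter> U" "generate G T' = ?B \<inter> U"
    "card T' \<le> card (coset_orbit G U ?B) * card T"
    using schreier_generators[OF T(2,1) refl sU finO] by blast
  have T'c: "T' \<subseteq> carrier G" using T'(2) Bc by auto
  define V where "V = generate G (TA \<union> T')"
  have V: "V = generate G (A \<union> (?B \<inter> U))"
    unfolding V_def using generate_Un_generate[OF TA(2) T'c] TA(3) T'(3) by simp
  have AU: "A \<subseteq> U" using U1(2) U'(2) U0(2) by (auto simp: U_def)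
  have VU: "V \<subseteq> U" unfolding V using AU by (intro generate_subgroup_incl sU) auto
  have sV: "subgroup V G" unfolding V_def using TA(2) T'c by (intro generate_is_subgroup) auto
  have "infinite (rcosets V)"
  proof
    assume "finite (rcosets V)"
    then have Vfi: "fi_subgroup G V" using sV by (simp add: fi_subgroup_def)
    have mono: "card (rcosets H) \<le> card (rcosets K)"
      if "fi_subgroup G H" "fi_subgroup G K" "K \<subseteq> H" for H K
      using that coset_orbit_antimono(2)[of K H "carrier G"] subgroup_self
      unfolding rcosets_eq_coset_orbit fi_subgroup_def by blast
    let ?u = "card (rcosets U)" and ?w = "card (rcosets W)" and ?k = "card (coset_orbit G W A)"
    have "?c * ?u \<le> ?c * card (rcosets V)"
      using mono[OF U Vfi VU] rank_gradient_pos by simp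
    also have "\<dots> \<le> card (TA \<union> T')"
      using rank_gradient_le_card_generators[OF Vfi] TA(1,2) T'(1) T'c V_def by blast
    also have "\<dots> \<le> card TA + card T'" using card_Un_le by (metis of_nat_add of_nat_le_iff)
    also have "\<dots> \<le> card TA + card (coset_orbit G U ?B) * card T"
      using of_nat_mono[OF T'(4), where 'a = real] by simp
    finally have upper: "?c * ?u \<le> real (card TA) + card (coset_orbit G U ?B) * card T" by simp
    have "2 * real (card TA) < ?c * ?u"
    proof -
      have "?c * card (rcosets U') \<le> ?c * ?u"
        using mono[OF U'(1) U] rank_gradient_pos by (auto simp: U_def)
      then show ?thesis using U'(3) by linarith
    qed
    moreover have "2 * real (card (coset_orbit G U ?B) * card T) < ?c * ?u"
    proof -
      \<comment> \<open>With B = \<open>?B\<close>: [B : B \<inter> U] [G : W] \<le>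
        [G : W \<inter> U] = [G : U] [U : U \<inter> W], and the last factor is at most
        \<open>?k\<close> by the choice of \<open>U1\<close>.\<close>
      have "card (coset_orbit G U ?B) * ?w \<le> card (rcosets (W \<inter> U))"
        by (rule card_coset_orbit_le[OF U W])
      also have "\<dots> = ?u * card (coset_orbit G W U)"
        using card_rcosets_Int[OF sU sW] fi_subgroup_Int[OF U W(1)]
        by (simp add: fi_subgroup_def Int_commute)
      also have "\<dots> \<le> ?u * ?k"
      proof -
        have "coset_orbit G W U \<subseteq> coset_orbit G W A"
          using U1(3) coset_orbit_mono[of U U1 G W] by (auto simp: U_def)
        then show ?thesis
          using card_mono[OF fi_subgroup_finite_coset_orbit[OF W(1) Ac]] by simp
      qed
      finally have "card (coset_orbit G U ?B) * ?w * (2 * card T) \<le> ?u * ?k * (2 * card T)"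
        by (rule mult_right_mono) simp
      then have "real (2 * (card (coset_orbit G U ?B) * card T)) * ?w \<le> ?u * real (2 * ?k * card T)"
        unfolding of_nat_mult[symmetric] of_nat_le_iff by (simp add: algebra_simps)
      also have "\<dots> < ?u * (?c * ?w)"
        using small card_rcosets_pos[OF U] by (intro mult_strict_left_mono) auto
      finally have "real (2 * (card (coset_orbit G U ?B) * card T)) * ?w < (?c * ?u) * ?w"
        by (simp add: algebra_simps)
      then show ?thesis by (simp add: mult_less_cancel_right)
    qed
    ultimately show False using upper by linarith
  qed
  moreover have "fg_subgroup G (?B \<inter> U)" using fg_subgroup_generate[OF T'(1) T'c] T'(3) by simp
  moreover have "finite (coset_orbit G (?B \<inter> U) ?B)"
    using coset_orbit_antimono(1)[OF sU subgroups_Inter_pair[OF sB sU] Bc _ sB finO] by blast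
  moreover have "?B \<inter> U \<subseteq> ?B \<inter> U0" by (auto simp: U_def)
  ultimately show ?thesis unfolding V by blast
qed

lemma ex_finite_index_join_infinite_index:
  assumes A: "fg_subgroup G A" "infinite (rcosets A)"
    and B: "fg_subgroup G B" "infinite (rcosets B)"
    and U0: "fi_subgroup G U0" "A \<subseteq> U0"
  shows "\<exists>B0. fg_subgroup G B0 \<and> B0 \<subseteq> B \<inter> U0 \<and>
    finite (coset_orbit G B0 B) \<and> infinite (rcosets (generate G (A \<union> B0)))"
proof -
  have sA: "subgroup A G" and sB: "subgroup B G" and Ac: "A \<subseteq> carrier G"
    using A(1) B(1) subgroup.subset by (auto simp: fg_subgroup_def)
  obtain T where T: "finite T" "T \<subseteq> carrier G" "generate G T = B"
    using fg_subgroupE[OF B(1)] .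
  obtain TA where TA: "finite TA" "TA \<subseteq> carrier G" "generate G TA = A"
    using fg_subgroupE[OF A(1)] .
  obtain W where W: "fi_subgroup G W" "B \<subseteq> W" "2 * real (card T) < rank_gradient G * card (rcosets W)"
    using ex_fi_subgroup_large_index[OF B] .
  have sW: "subgroup W G" using W(1) by (simp add: fi_subgroup_def)
  have finA: "finite (coset_orbit G W A)" using fi_subgroup_finite_coset_orbit[OF W(1) Ac] .
  obtain T1 where T1: "finite T1" "T1 \<subseteq> A \<inter> W" "generate G T1 = A \<inter> W"
    using schreier_generators[OF TA(2,1,3) sW finA] by blast
  have sA1: "subgroup (A \<inter> W) G" using sA sW by (rule subgroups_Inter_pair)
  have A1: "fg_subgroup G (A \<inter> W)" "infinite (rcosets (A \<inter> W))"
    using T1 sA1 A(2) infinite_rcosets_antimono[OF sA sA1] by (auto simp: fg_subgroup_def)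
  \<comment> \<open>The group \<open>A \<inter> W\<close> fixes the base point, so the size of
    \<open>W\<close> chosen against \<open>card T\<close> suffices.\<close>
  have "coset_orbit G W (A \<inter> W) \<subseteq> {W}"
    using coset_join2[OF _ sW] Ac by (auto simp: coset_orbit_def)
  then have "card (coset_orbit G W (A \<inter> W)) \<le> 1" using card_mono[of "{W}"] by fastforce
  then have "2 * card (coset_orbit G W (A \<inter> W)) * card T \<le> 2 * card T" by simp
  then have small: "2 * card (coset_orbit G W (A \<inter> W)) * card T < rank_gradient G * card (rcosets W)"
    using W(3) by linarith
  obtain B1 where B1: "fg_subgroup G B1" "B1 \<subseteq> B" "finite (coset_orbit G B1 B)"
    "infinite (rcosets (generate G (A \<inter> W \<union> B1)))"
    using ex_finite_index_join_infinite_index_aux[OF A1 T(1,2) W(1) _ small fi_subgroup_carrier]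
      T(3) W(2) Ac by auto
  obtain TB where TB: "finite TB" "TB \<subseteq> carrier G" "generate G TB = B1"
    using fg_subgroupE[OF B1(1)] .
  let ?J = "generate G (A \<inter> W \<union> B1)"
  have T1c: "T1 \<subseteq> carrier G" using T1(2) Ac by auto
  have "?J = generate G (T1 \<union> TB)"
    using generate_Un_generate[OF T1c TB(2)] T1(3) TB(3) by simp
  then have "fg_subgroup G ?J" using fg_subgroup_generate[of "T1 \<union> TB"] T1(1) T1c TB by simp
  \<comment> \<open>The index [A : A \<inter> W] is fixed before \<open>W'\<close> is chosen. As
    \<open>A \<inter> W \<subseteq> W'\<close>, it bounds the orbit of \<open>A\<close> on the
    cosets of \<open>W'\<close>.\<close>
  then obtain W' where W': "fi_subgroup G W'" "?J \<subseteq> W'"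
    "2 * card (coset_orbit G (A \<inter> W) A) * real (card TB) < rank_gradient G * card (rcosets W')"
    using ex_fi_subgroup_large_index[OF _ B1(4)] by blast
  have sW': "subgroup W' G" using W'(1) by (simp add: fi_subgroup_def)
  have sub: "A \<inter> W \<subseteq> W'" "B1 \<subseteq> W'" using W'(2) by (auto intro: generate.incl)
  have "card (coset_orbit G W' A) \<le> card (coset_orbit G (A \<inter> W) A)"
    using sub coset_orbit_antimono(1)[OF sW sA1 Ac _ sA finA]
    by (intro coset_orbit_antimono(2)[OF sA1 sW' Ac _ sA]) auto
  then have "2 * card (coset_orbit G W' A) * card TB \<le> 2 * card (coset_orbit G (A \<inter> W) A) * card TB"
    by simp
  then have "real (2 * card (coset_orbit G W' A) * card TB)
      \<le> real (2 * card (coset_orbit G (A \<inter> W) A) * card TB)"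
    by (simp only: of_nat_le_iff)
  then have "2 * card (coset_orbit G W' A) * card TB < rank_gradient G * card (rcosets W')"
    using W'(3) by simp
  then obtain B2 where B2: "fg_subgroup G B2" "B2 \<subseteq> B1 \<inter> U0" "finite (coset_orbit G B2 B1)"
    "infinite (rcosets (generate G (A \<union> B2)))"
    using ex_finite_index_join_infinite_index_aux[OF A TB(1,2) W'(1) _ _ U0] TB(3) sub(2) by auto
  have "finite (coset_orbit G B2 B)"
    using finite_coset_orbit_trans[OF _ _ sB B2(3) B1(3,2)] B1(1) B2(1)
    by (auto simp: fg_subgroup_def)
  then show ?thesis using B2 B1(2) by blast
qed

section \<open>Normal subgroups inside finitely generated subgroups of infinite index\<close>

text \<open>With \<open>U \<supseteq> A\<close> of large index, \<open>[M : M \<inter> R] \<ge> |F|\<close> and \<open>Q = U \<inter> R\<close>, \<open>P = MQ\<close>, the group \<open>Q\<close> is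
  generated by at most \<open>[G : P] d(G) + [A : A \<inter> Q] d(A)\<close> elements, which is at most
  \<open>[G : Q] (d(G) / |F| + d(A) / [G : U])\<close>.\<close>

lemma normal_subset_card_le:
  assumes M: "M \<lhd> G" "M \<subseteq> A" and A: "fg_subgroup G A" "infinite (rcosets A)"
    and S: "finite S" "S \<subseteq> carrier G" "generate G S = carrier G"
    and F: "finite F" "F \<subseteq> M"
  shows "rank_gradient G * card F \<le> card S"
proof (rule ccontr)
  let ?c = "rank_gradient G"
  assume neg: "\<not> ?thesis"
  obtain TA where TA: "finite TA" "TA \<subseteq> carrier G" "generate G TA = A"
    using fg_subgroupE[OF A(1)] .
  have sM: "subgroup M G" and Mc: "M \<subseteq> carrier G"
    using M(1) normal_imp_subgroup subgroup.subset by blast+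
  have sA: "subgroup A G" and Ac: "A \<subseteq> carrier G"
    using A(1) subgroup.subset by (auto simp: fg_subgroup_def)
  \<comment> \<open>The orbit on the cosets of the trivial subgroup is a copy of \<open>M\<close>,
    so LERF for that subgroup yields \<open>R\<close>.\<close>
  have "card F \<le> card (coset_orbit G {\<one>} M)" if "finite (coset_orbit G {\<one>} M)"
  proof -
    have inj: "inj_on (\<lambda>h. {h}) M" by (auto simp: inj_on_def)
    then have "finite M" using that coset_orbit_one[OF Mc] finite_imageD by fastforce
    then show ?thesis using coset_orbit_one[OF Mc] card_image[OF inj] F card_mono by metis
  qed
  then obtain R where R: "fi_subgroup G R" "card F \<le> card (coset_orbit G R M)"
    using LERF_large_coset_orbit[OF LERF fg_subgroup_one sM] by blast
  let ?m = "card (coset_orbit G R M)" and ?s = "card S" and ?a = "card TA"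
  have "?c * card F \<le> ?c * ?m" using R(2) rank_gradient_pos by simp
  then have d: "?c * ?m - ?s > 0" using neg by linarith
  \<comment> \<open>The constant is what makes \<open>?m * ?a\<close> smaller than
    \<open>?n * (?c * ?m - ?s)\<close>, which the final count contradicts.\<close>
  obtain U where U: "fi_subgroup G U" "A \<subseteq> U"
    "?c * (real (?m * ?a) / (?c * ?m - ?s)) < ?c * card (rcosets U)"
    using ex_fi_subgroup_large_index[OF A] .
  let ?n = "card (rcosets U)"
  have "real (?m * ?a) / (?c * ?m - ?s) < ?n"
    using U(3) rank_gradient_pos by (simp only: mult_less_cancel_left_pos)
  then have n: "real (?m * ?a) < ?n * (?c * ?m - ?s)" using d by (simp add: pos_divide_less_eq)
  define Q where "Q = U \<inter> R"
  have Q: "fi_subgroup G Q" unfolding Q_def using U(1) R(1) by (rule fi_subgroup_Int)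
  have sQ: "subgroup Q G" and Qc: "Q \<subseteq> carrier G"
    using Q subgroup.subset by (auto simp: fi_subgroup_def)
  define P where "P = M <#> Q"
  have sP: "subgroup P G" unfolding P_def using M(1) sQ by (rule set_mult_normal_subgroup)
  have QP: "Q \<subseteq> P"
    unfolding P_def set_mult_def using subgroup.one_closed[OF sM] Qc by force
  have MP: "M \<subseteq> P"
    unfolding P_def set_mult_def using subgroup.one_closed[OF sQ] Mc by force
  have P: "fi_subgroup G P"
    using coset_orbit_antimono(1)[OF sQ sP order_refl _ subgroup_self] QP Q sP
    unfolding fi_subgroup_def rcosets_eq_coset_orbit by blast
  obtain TP where TP: "finite TP" "generate G TP = P" "TP \<subseteq> P"
    "card TP \<le> card (rcosets P) * ?s"
    using schreier_generators[OF S(2,1,3) sP] P subgroup.subset[OF sP]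
    unfolding fi_subgroup_def rcosets_eq_coset_orbit by (auto simp: Int_absorb1)
  obtain TQ where TQ: "finite TQ" "TQ \<subseteq> A \<inter> Q" "generate G TQ = A \<inter> Q"
    "card TQ \<le> card (coset_orbit G Q A) * ?a"
    using schreier_generators[OF TA(2,1,3) sQ fi_subgroup_finite_coset_orbit[OF Q Ac]] by blast
  have "\<forall>t\<in>P. \<exists>q\<in>Q. t \<in> M #> q" by (auto simp: P_def set_mult_def r_coset_def)
  then have "\<forall>t\<in>TP. \<exists>q\<in>Q. t \<in> M #> q" using TP(3) by blast
  then obtain f where f: "\<And>t. t \<in> TP \<Longrightarrow> f t \<in> Q" "\<And>t. t \<in> TP \<Longrightarrow> t \<in> M #> f t"
    by metis
  let ?T = "f ` TP \<union> TQ"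
  have Tc: "?T \<subseteq> Q" using f(1) TQ(2) by auto
  \<comment> \<open>\<open>Q / (Q \<inter> M)\<close> is \<open>P / M\<close>, so lifts of generators of \<open>P\<close> together with generators of
    \<open>Q \<inter> A\<close>, which contains \<open>Q \<inter> M\<close>, generate \<open>Q\<close>.\<close>
  have gen: "generate G ?T = Q"
  proof
    show "generate G ?T \<subseteq> Q" using Tc sQ by (rule generate_subgroup_incl)
    let ?E = "generate G (f ` TP)"
    have sE: "subgroup ?E G" using f(1) Qc by (intro generate_is_subgroup) auto
    have "TP \<subseteq> M <#> ?E"
    proof
      fix t assume t: "t \<in> TP"
      then have "f t \<in> ?E" by (auto intro: generate.incl)
      then show "t \<in> M <#> ?E" using f(2)[OF t] by (auto simp: set_mult_def r_coset_def)
    qed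
    then have PE: "P \<subseteq> M <#> ?E"
      using generate_subgroup_incl[OF _ set_mult_normal_subgroup[OF M(1) sE]] TP(2) by blast
    have EQ: "?E \<subseteq> Q" using f(1) sQ by (intro generate_subgroup_incl) auto
    show "Q \<subseteq> generate G ?T"
    proof
      fix q assume q: "q \<in> Q"
      then obtain m e where me: "m \<in> M" "e \<in> ?E" "q = m \<otimes> e"
        using QP PE by (auto simp: set_mult_def)
      have c: "m \<in> carrier G" "e \<in> carrier G" using me Mc EQ Qc by auto
      have "e \<in> Q" using me EQ by auto
      then have "q \<otimes> inv e \<in> Q" using q sQ by (simp add: subgroup.m_closed subgroup.m_inv_closed)
      moreover have "q \<otimes> inv e = m" using me(3) c by (simp add: m_assoc)
      ultimately have "m \<in> generate G TQ" using me(1) M(2) TQ(3) by auto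
      then have "m \<in> generate G ?T" using mono_generate[of TQ ?T] by auto
      moreover have "e \<in> generate G ?T" using me(2) mono_generate[of "f ` TP" ?T] by auto
      ultimately show "q \<in> generate G ?T" using me(3) generate.eng by fast
    qed
  qed
  let ?q = "card (rcosets Q)" and ?p = "card (rcosets P)" and ?o = "card (coset_orbit G Q A)"
  have "?c * ?q \<le> card ?T"
    using rank_gradient_le_card_generators[OF Q _ _ gen] TP(1) TQ(1) Tc Qc by auto
  also have "card ?T \<le> card (f ` TP) + card TQ" by (rule card_Un_le)
  also have "\<dots> \<le> ?p * ?s + ?o * ?a"
    using TP(4) TQ(4) card_image_le[OF TP(1), of f] by linarith
  finally have upper: "?c * ?q \<le> real (?p * ?s + ?o * ?a)" by simp
  have "?m \<le> card (coset_orbit G Q M)"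
    using R(1) by (intro coset_orbit_antimono(2)[OF sQ _ Mc _ sM fi_subgroup_finite_coset_orbit[OF Q Mc]])
      (auto simp: fi_subgroup_def Q_def)
  then have "?m * ?p \<le> card (coset_orbit G Q M) * ?p" by simp
  also have "\<dots> \<le> card (rcosets (P \<inter> Q))" using Q P MP by (rule card_coset_orbit_le)
  also have "P \<inter> Q = Q" using QP by auto
  finally have mp: "?m * ?p \<le> ?q" .
  have "?o * ?n \<le> card (rcosets (U \<inter> Q))" using Q U(1,2) by (rule card_coset_orbit_le)
  also have "U \<inter> Q = Q" by (auto simp: Q_def)
  finally have on: "?o * ?n \<le> ?q" .
  \<comment> \<open>After multiplication by \<open>?m * ?n\<close>, both \<open>?m * ?p\<close> and
    \<open>?o * ?n\<close> can be replaced by their bound \<open>?q\<close>, which then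
    cancels.\<close>
  have "?c * ?q * (?m * ?n) \<le> real (?p * ?s + ?o * ?a) * (?m * ?n)"
    using upper by (intro mult_right_mono) auto
  also have "\<dots> = real (?m * ?p * (?n * ?s) + ?o * ?n * (?m * ?a))" by (simp add: algebra_simps)
  also have "\<dots> \<le> real (?q * (?n * ?s) + ?q * (?m * ?a))"
    unfolding of_nat_le_iff using mp on by (intro add_mono mult_right_mono) auto
  finally have "?q * (?n * (?c * ?m - ?s)) \<le> ?q * real (?m * ?a)" by (simp add: algebra_simps)
  moreover have "real ?q > 0" using card_rcosets_pos[OF Q] by simp
  ultimately have "?n * (?c * ?m - ?s) \<le> real (?m * ?a)" by (simp only: mult_le_cancel_left_pos)
  then show False using n by linarith
qed

section \<open>The ascending chain\<close>

text \<open>Here \<open>U\<close> is a finite index ceiling for all later members of the chain: a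
  conjugate left out of \<open>U'\<close> stays out of their union. One set \<open>F\<close> serves
  both as generators of a subgroup to be absorbed and as a candidate subset of the kernel.\<close>

lemma chain_step:
  assumes A: "fg_subgroup G A" "infinite (rcosets A)" and U: "fi_subgroup G U" "A \<subseteq> U"
    and F: "finite F" "F \<subseteq> carrier G"
    and S: "finite S" "S \<subseteq> carrier G" "generate G S = carrier G"
  shows "\<exists>A' U'. fg_subgroup G A' \<and> infinite (rcosets A') \<and> fi_subgroup G U' \<and> A' \<subseteq> U' \<and>
    A \<subseteq> A' \<and> U' \<subseteq> U \<and>
    (infinite (rcosets (generate G F)) \<longrightarrow> finite (coset_orbit G A' (generate G F))) \<and>
    (rank_gradient G * card F > card S \<longrightarrow> \<not> conjugates F \<subseteq> U')"
proof -
  let ?L = "generate G F"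
  have L: "fg_subgroup G ?L" "subgroup ?L G" "?L \<subseteq> carrier G"
    using F fg_subgroup_generate generate_is_subgroup generate_incl by auto
  obtain A' where A': "fg_subgroup G A'" "infinite (rcosets A')" "A \<subseteq> A'" "A' \<subseteq> U"
    "infinite (rcosets ?L) \<longrightarrow> finite (coset_orbit G A' ?L)"
  proof (cases "infinite (rcosets ?L)")
    case True
    obtain B where B: "fg_subgroup G B" "B \<subseteq> ?L \<inter> U" "finite (coset_orbit G B ?L)"
      "infinite (rcosets (generate G (A \<union> B)))"
      using ex_finite_index_join_infinite_index[OF A L(1) True U] by blast
    obtain TA where TA: "finite TA" "TA \<subseteq> carrier G" "generate G TA = A"
      using fg_subgroupE[OF A(1)] .
    obtain TB where TB: "finite TB" "TB \<subseteq> carrier G" "generate G TB = B"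
      using fg_subgroupE[OF B(1)] .
    have "fg_subgroup G (generate G (A \<union> B))"
      using generate_Un_generate[OF TA(2) TB(2)] TA TB fg_subgroup_generate[of "TA \<union> TB"] by simp
    moreover from this have "finite (coset_orbit G (generate G (A \<union> B)) ?L)"
      using B(1) generate.incl[of _ "A \<union> B" G]
      by (intro coset_orbit_antimono(1)[OF _ _ L(3) _ L(2) B(3)]) (auto simp: fg_subgroup_def)
    moreover have "generate G (A \<union> B) \<subseteq> U"
      using B(2) U by (intro generate_subgroup_incl) (auto simp: fi_subgroup_def)
    moreover have "A \<subseteq> generate G (A \<union> B)" by (auto intro: generate.incl)
    ultimately show ?thesis using that B(4) by blast
  next
    case False
    then show ?thesis using that A U(2) by blast
  qed
  show ?thesis
  proof (cases "rank_gradient G * card F > card S")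
    case True
    have "\<not> conjugates F \<subseteq> A'"
    proof
      assume "conjugates F \<subseteq> A'"
      then have "generate G (conjugates F) \<subseteq> A'"
        using A'(1) by (intro generate_subgroup_incl) (auto simp: fg_subgroup_def)
      moreover have "F \<subseteq> generate G (conjugates F)"
        using subset_conjugates[OF F(2)] by (auto intro: generate.incl)
      ultimately have "rank_gradient G * card F \<le> card S"
        using normal_subset_card_le[OF generate_conjugates_normal[OF F(2)] _ A'(1,2) S F(1)] by blast
      then show False using True by linarith
    qed
    then obtain x where x: "x \<in> conjugates F" "x \<notin> A'" by blast
    obtain V where V: "fi_subgroup G V" "A' \<subseteq> V" "x \<notin> V"
      using LERF_fi_subgroup_avoiding[OF LERF A'(1) x(2)] .
    have "fi_subgroup G (U \<inter> V)" "A' \<subseteq> U \<inter> V" "U \<inter> V \<subseteq> U" "\<not> conjugates F \<subseteq> U \<inter> V"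
      using fi_subgroup_Int U(1) V A'(4) x(1) by auto
    then show ?thesis using A' by blast
  next
    case False
    then show ?thesis using A' U(1) by blast
  qed
qed

lemma ex_subgroup_with_finite_orbits:
  assumes S: "finite S" "S \<subseteq> carrier G" "generate G S = carrier G" and inf: "infinite (carrier G)"
  obtains H where "subgroup H G"
    "\<And>L. fg_subgroup G L \<Longrightarrow> infinite (rcosets L) \<Longrightarrow> finite (coset_orbit G H L)"
    "\<And>F. finite F \<Longrightarrow> F \<subseteq> carrier G \<Longrightarrow> rank_gradient G * card F > card S \<Longrightarrow> \<not> conjugates F \<subseteq> H"
proof -
  let ?Fin = "{F. F \<subseteq> carrier G \<and> finite F}"
  have "countable (carrier G)"
    using countable_generate[OF countable_finite[OF S(1)] S(2)] S(3) by simp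
  then have "countable ?Fin" using countable_Collect_finite_subset[of "carrier G"] by (simp add: conj_commute)
  moreover have "?Fin \<noteq> {}" by blast
  ultimately obtain e :: "nat \<Rightarrow> 'a set" where e: "range e = ?Fin"
    using range_from_nat_into by metis
  define p where "p s \<longleftrightarrow> fg_subgroup G (fst s) \<and> infinite (rcosets (fst s)) \<and>
    fi_subgroup G (snd s) \<and> fst s \<subseteq> snd s" for s
  define next_ok where "next_ok n s s' \<longleftrightarrow> fst s \<subseteq> fst s' \<and> snd s' \<subseteq> snd s \<and>
    (infinite (rcosets (generate G (e n))) \<longrightarrow> finite (coset_orbit G (fst s') (generate G (e n)))) \<and>
    (rank_gradient G * card (e n) > card S \<longrightarrow> \<not> conjugates (e n) \<subseteq> snd s')" for n s s'
  have en: "finite (e n)" "e n \<subseteq> carrier G" for n using e by auto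
  have "\<exists>f. \<forall>n. p (f n) \<and> next_ok n (f n) (f (Suc n))"
  proof (rule dependent_nat_choice)
    \<comment> \<open>The chain starts at the trivial subgroup, which has infinite index because the
      group is infinite.\<close>
    have "infinite (rcosets {\<one>})"
      unfolding rcosets_eq_coset_orbit using inf coset_orbit_one[OF order_refl]
      by (auto dest!: finite_imageD simp: inj_on_def)
    then have "p ({\<one>}, carrier G)"
      unfolding p_def using fg_subgroup_one fi_subgroup_carrier by simp
    then show "\<exists>s. p s" by blast
  next
    fix s n assume "p s"
    then have s: "fg_subgroup G (fst s)" "infinite (rcosets (fst s))"
      "fi_subgroup G (snd s)" "fst s \<subseteq> snd s"
      by (simp_all add: p_def)
    obtain A' U' where "fg_subgroup G A' \<and> infinite (rcosets A') \<and> fi_subgroup G U' \<and> A' \<subseteq> U' \<and>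
      fst s \<subseteq> A' \<and> U' \<subseteq> snd s \<and>
      (infinite (rcosets (generate G (e n))) \<longrightarrow> finite (coset_orbit G A' (generate G (e n)))) \<and>
      (rank_gradient G * card (e n) > card S \<longrightarrow> \<not> conjugates (e n) \<subseteq> U')"
      using chain_step[OF s en S, of n] by (elim exE) (rule that)
    then have "p (A', U') \<and> next_ok n s (A', U')" unfolding p_def next_ok_def by simp
    then show "\<exists>s'. p s' \<and> next_ok n s s'" by blast
  qed
  then obtain f where f: "\<And>n. p (f n)" "\<And>n. next_ok n (f n) (f (Suc n))" by blast
  define A where "A n = fst (f n)" for n
  define U where "U n = snd (f n)" for n
  have A: "subgroup (A n) G" "A n \<subseteq> U n" for n
    using f(1)[of n] by (auto simp: p_def fg_subgroup_def A_def U_def)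
  have "A n \<subseteq> A (Suc n)" "U (Suc n) \<subseteq> U n" for n
    using f(2)[of n] by (auto simp: next_ok_def A_def U_def)
  note A_mono = lift_Suc_mono_le[of A, OF this(1)] and U_mono = lift_Suc_antimono_le[of U, OF this(2)]
  define H where "H = (\<Union>n. A n)"
  have HU: "H \<subseteq> U n" for n
  proof -
    \<comment> \<open>Both are compared at stage \<open>max k n\<close>, since the \<open>A\<close>
      increase and the \<open>U\<close> decrease.\<close>
    have "A k \<subseteq> U n" for k
      using A_mono[of k "max k n"] A(2)[of "max k n"] U_mono[of n "max k n"] by auto
    then show ?thesis by (auto simp: H_def)
  qed
  have sH: "subgroup H G"
  proof (rule subgroupI)
    show "H \<subseteq> carrier G" using subgroup.subset[OF A(1)] by (auto simp: H_def)
    show "H \<noteq> {}" using subgroup.one_closed[OF A(1)] by (auto simp: H_def)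
    show "inv a \<in> H" if "a \<in> H" for a
      using that subgroup.m_inv_closed[OF A(1)] by (auto simp: H_def)
    show "a \<otimes> b \<in> H" if ab: "a \<in> H" "b \<in> H" for a b
    proof -
      obtain m n where "a \<in> A m" "b \<in> A n" using ab by (auto simp: H_def)
      then have "a \<in> A (max m n)" "b \<in> A (max m n)"
        using A_mono[of m "max m n"] A_mono[of n "max m n"] by auto
      then show ?thesis using subgroup.m_closed[OF A(1)] by (auto simp: H_def)
    qed
  qed
  show thesis
  proof (rule that[OF sH])
    fix L assume L: "fg_subgroup G L" "infinite (rcosets L)"
    obtain T where T: "finite T" "T \<subseteq> carrier G" "generate G T = L" using fg_subgroupE[OF L(1)] .
    then have "T \<in> range e" using e by simp
    then obtain n where "e n = T" by auto
    then have fin: "finite (coset_orbit G (A (Suc n)) L)"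
      using f(2)[of n] T(3) L(2) by (simp add: next_ok_def A_def)
    have "subgroup L G" "L \<subseteq> carrier G" using L(1) subgroup.subset by (auto simp: fg_subgroup_def)
    then show "finite (coset_orbit G H L)"
      by (intro coset_orbit_antimono(1)[OF A(1) sH _ _ _ fin]) (auto simp: H_def)
  next
    fix F assume F: "finite F" "F \<subseteq> carrier G" "rank_gradient G * card F > card S"
    then have "F \<in> range e" using e by simp
    then obtain n where "e n = F" by auto
    then have "\<not> conjugates F \<subseteq> U (Suc n)" using f(2)[of n] F(3) by (simp add: next_ok_def U_def)
    then show "\<not> conjugates F \<subseteq> H" using HU by blast
  qed
qed

end

section \<open>The action on cosets\<close>

context group
begin

lemma conj_group_hom:
  assumes "g \<in> carrier G"
  shows "group_hom G G (\<lambda>x. g \<otimes> x \<otimes> inv g)"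
proof -
  have "(\<lambda>x. g \<otimes> x \<otimes> inv g) \<in> hom G G"
    using assms by (intro homI) (simp_all add: m_assoc flip: m_assoc[of "inv g" g])
  then show ?thesis by (simp add: group_hom_def group_hom_axioms_def group_axioms)
qed

lemma fg_subgroup_conj:
  assumes "g \<in> carrier G" "fg_subgroup G L"
  shows "fg_subgroup G ((\<lambda>x. g \<otimes> x \<otimes> inv g) ` L)"
proof -
  obtain T where T: "finite T" "T \<subseteq> carrier G" "generate G T = L" using fg_subgroupE[OF assms(2)] .
  have "(\<lambda>x. g \<otimes> x \<otimes> inv g) ` L = generate G ((\<lambda>x. g \<otimes> x \<otimes> inv g) ` T)"
    using group_hom.generate_img[OF conj_group_hom[OF assms(1)] T(2)] T(3) by simp
  then show ?thesis using T assms(1) by (auto intro!: fg_subgroup_generate)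
qed

text \<open>With L' the conjugate, L' g x = g L x, so the coset of \<open>g \<otimes> x\<close>
  modulo L' determines \<open>L #> x\<close>.\<close>

lemma infinite_rcosets_conj:
  assumes g: "g \<in> carrier G" and L: "subgroup L G" "infinite (rcosets L)"
    and L': "subgroup ((\<lambda>x. g \<otimes> x \<otimes> inv g) ` L) G" (is "subgroup ?L' G")
  shows "infinite (rcosets ?L')"
proof
  assume fin: "finite (rcosets ?L')"
  have Lc: "L \<subseteq> carrier G" using subgroup.subset[OF L(1)] .
  have "finite ((\<lambda>x. L #> x) ` carrier G)"
  proof (rule card_image_le_if_determines(1))
    show "finite ((\<lambda>x. ?L' #> (g \<otimes> x)) ` carrier G)"
      using g subgroup.subset[OF L'] by (intro finite_subset[OF _ fin]) (auto intro!: rcosetsI)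
    fix x y assume xy: "x \<in> carrier G" "y \<in> carrier G" "?L' #> (g \<otimes> x) = ?L' #> (g \<otimes> y)"
    then have "(g \<otimes> x) \<otimes> inv (g \<otimes> y) \<in> ?L'" using g r_coset_eq_iff[OF L'] by simp
    then obtain l where l: "l \<in> L" "g \<otimes> x \<otimes> inv (g \<otimes> y) = g \<otimes> l \<otimes> inv g" by blast
    then have "g \<otimes> (x \<otimes> inv y) \<otimes> inv g = g \<otimes> l \<otimes> inv g"
      using g xy by (simp add: inv_mult_group m_assoc)
    then have "x \<otimes> inv y = l" using g xy l(1) Lc by (simp add: subsetD)
    then show "L #> x = L #> y" using l(1) r_coset_eq_iff[OF L(1)] xy by simp
  qed
  then show False using L(2) by (simp add: rcosets_eq_coset_orbit coset_orbit_def)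
qed

lemma transitive_right_action_rcosets:
  assumes "subgroup H G"
  shows "transitive_right_action G (rcosets H) (\<lambda>C g. C #> g)"
proof -
  have Hc: "H \<subseteq> carrier G" using assms by (rule subgroup.subset)
  have C: "C \<subseteq> carrier G" if "C \<in> rcosets H" for C
    using rcosets_subset_PowG[OF assms] that by blast
  have "C #> g \<in> rcosets H" if "C \<in> rcosets H" "g \<in> carrier G" for C g
    using that Hc by (auto simp: RCOSETS_def coset_mult_assoc)
  moreover have "rcosets H \<noteq> {}" by (auto simp: RCOSETS_def)
  moreover have "\<exists>g\<in>carrier G. C #> g = D" if CD: "C \<in> rcosets H" "D \<in> rcosets H" for C D
  proof -
    obtain c d where "c \<in> carrier G" "C = H #> c" "d \<in> carrier G" "D = H #> d"
      using CD by (auto simp: RCOSETS_def)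
    then show ?thesis
      using Hc by (intro bexI[of _ "inv c \<otimes> d"])
        (simp_all add: coset_mult_assoc flip: m_assoc)
  qed
  ultimately show ?thesis
    unfolding transitive_right_action_def right_action_def using C by (simp add: coset_mult_assoc)
qed

text \<open>An element \<open>f\<close> fixes \<open>H #> x\<close> exactly when
  \<open>x \<otimes> f \<otimes> inv x\<close> lies in \<open>H\<close>.\<close>

lemma conjugates_kernel_subset:
  assumes H: "subgroup H G" and F: "F \<subseteq> {g \<in> carrier G. \<forall>C\<in>rcosets H. C #> g = C}"
  shows "conjugates F \<subseteq> H"
proof
  fix y assume "y \<in> conjugates F"
  then obtain x f where xf: "x \<in> carrier G" "f \<in> F" "y = x \<otimes> f \<otimes> inv x"
    by (auto simp: conjugates_def)
  have f: "f \<in> carrier G" "H #> x #> f = H #> x"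
    using xf F rcosetsI[OF subgroup.subset[OF H]] by auto
  then have "H #> (x \<otimes> f) = H #> x"
    using xf(1) subgroup.subset[OF H] by (simp add: coset_mult_assoc)
  then show "y \<in> H" using xf f r_coset_eq_iff[OF H, of "x \<otimes> f" x] by simp
qed

end

theorem theorem1p3:
  fixes G :: "('a, 'b) monoid_scheme"
  assumes "group G"
    and "fg_subgroup G (carrier G)"
    and "LERF G"
    and "rank_gradient G > 0"
  shows "\<exists>(\<Omega> :: 'a set set) act. transitive_right_action G \<Omega> act \<and>
           finite {g \<in> carrier G. \<forall>x\<in>\<Omega>. act x g = x} \<and>
           (\<forall>L x. fg_subgroup G L \<and> infinite (rcosets\<^bsub>G\<^esub> L) \<and> x \<in> \<Omega> \<longrightarrow>
               finite ((\<lambda>l. act x l) ` L))"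
proof -
  interpret LERF_positive_rank_gradient G
    using assms by (simp add: LERF_positive_rank_gradient_def LERF_positive_rank_gradient_axioms_def)
  obtain S where S: "finite S" "S \<subseteq> carrier G" "generate G S = carrier G"
    using fg_subgroupE[OF assms(2)] .
  show ?thesis
  proof (cases "finite (carrier G)")
    case True
    \<comment> \<open>For finite \<open>G\<close> the one-point action works: no subgroup has
      infinite index, so the orbit condition is vacuous.\<close>
    then have "finite (rcosets\<^bsub>G\<^esub> L)" for L by (simp add: rcosets_eq_coset_orbit coset_orbit_def)
    then show ?thesis
      using True transitive_right_action_rcosets[OF subgroup_self]
      by (intro exI[of _ "rcosets\<^bsub>G\<^esub> (carrier G)"] exI[of _ "\<lambda>C g. C #>\<^bsub>G\<^esub> g"]) auto
  next
    case False
    obtain H where H: "subgroup H G"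
      "\<And>L. fg_subgroup G L \<Longrightarrow> infinite (rcosets\<^bsub>G\<^esub> L) \<Longrightarrow> finite (coset_orbit G H L)"
      "\<And>F. finite F \<Longrightarrow> F \<subseteq> carrier G \<Longrightarrow> rank_gradient G * card F > card S \<Longrightarrow> \<not> conjugates F \<subseteq> H"
      using ex_subgroup_with_finite_orbits[OF S False] by blast
    define N where "N = {g \<in> carrier G. \<forall>C\<in>rcosets\<^bsub>G\<^esub> H. C #>\<^bsub>G\<^esub> g = C}"
    have "finite N"
    proof (rule ccontr)
      assume inf: "infinite N"
      obtain n :: nat where n: "card S < n * rank_gradient G"
        using reals_Archimedean3[OF rank_gradient_pos] by blast
      obtain F where F: "F \<subseteq> N" "finite F" "card F = n"
        using infinite_arbitrarily_large[OF inf] by blast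
      have "\<not> conjugates F \<subseteq> H"
        using F n by (intro H(3)) (auto simp: mult.commute N_def)
      then show False using conjugates_kernel_subset[OF H(1) F(1)[unfolded N_def]] by contradiction
    qed
    moreover have "finite ((\<lambda>l. C #>\<^bsub>G\<^esub> l) ` L)"
      if L: "fg_subgroup G L" "infinite (rcosets\<^bsub>G\<^esub> L)" and C: "C \<in> rcosets\<^bsub>G\<^esub> H" for L C
    proof -
      obtain g where g: "g \<in> carrier G" "C = H #>\<^bsub>G\<^esub> g" using C by (auto simp: RCOSETS_def)
      \<comment> \<open>The orbit of \<open>C\<close> under \<open>L\<close> is the translate by
        \<open>g\<close> of the base point's orbit under \<open>?L'\<close>, again finitely
        generated of infinite index.\<close>
      let ?L' = "(\<lambda>x. g \<otimes>\<^bsub>G\<^esub> x \<otimes>\<^bsub>G\<^esub> inv\<^bsub>G\<^esub> g) ` L"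
      have L': "fg_subgroup G ?L'" using g(1) L(1) by (rule fg_subgroup_conj)
      have Lc: "L \<subseteq> carrier G" using L(1) subgroup.subset by (auto simp: fg_subgroup_def)
      have Hc: "H \<subseteq> carrier G" using subgroup.subset[OF H(1)] .
      have "infinite (rcosets\<^bsub>G\<^esub> ?L')"
        using L L' g(1) by (intro infinite_rcosets_conj) (auto simp: fg_subgroup_def)
      then have "finite ((\<lambda>D. D #>\<^bsub>G\<^esub> g) ` coset_orbit G H ?L')" using H(2)[OF L'] by simp
      moreover have "C #>\<^bsub>G\<^esub> l = (H #>\<^bsub>G\<^esub> (g \<otimes>\<^bsub>G\<^esub> l \<otimes>\<^bsub>G\<^esub> inv\<^bsub>G\<^esub> g)) #>\<^bsub>G\<^esub> g" if "l \<in> L" for l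
        using that g Lc Hc by (simp add: coset_mult_assoc m_assoc subsetD)
      then have "(\<lambda>l. C #>\<^bsub>G\<^esub> l) ` L \<subseteq> (\<lambda>D. D #>\<^bsub>G\<^esub> g) ` coset_orbit G H ?L'"
        by (auto simp: coset_orbit_def)
      ultimately show ?thesis by (rule finite_subset[rotated])
    qed
    ultimately show ?thesis
      using transitive_right_action_rcosets[OF H(1)] unfolding N_def
      by (intro exI[of _ "rcosets\<^bsub>G\<^esub> H"] exI[of _ "\<lambda>C g. C #>\<^bsub>G\<^esub> g"]) blast
  qed
qed

end
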